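(* Let $x\ge 1$ and $\rho\ge 2$ be integers satisfying $x^{\rho-1}\equiv 1\pmod{\rho}$. For each integer $n\ge 0$ let $S_n$ be the number of integer multiples of $\rho$ which are greater than $0$ and less than $x^{n+1}$, and let $J_n$ be the number of integer multiples of $\rho$ which are greater than $x^n$ and less than $x^{n+1}$. Put $$\pi=\sum_{i=0}^{\rho-2}J_i-(x-1)\sum_{i=1}^{\rho-1}\sum_{j=0}^{i-2}J_j ,$$ a constant depending only on $\rho$, $x$ and the initial terms $J_0,\dots,J_{\rho-2}$. Then for every integer $n\ge 0$, $$S_{n+\rho-1}=(x-1)\sum_{i=1}^{\rho-2}S_{n-i+\rho-1}+xS_n+\pi ,$$ or, equivalently, $$S_{n+\rho-1}=(x-1)\sum_{i=1}^{\rho-1}S_{n-i+\rho-1}+S_n+\pi .$$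
   Context: The sequence $(J_n)_{n\ge0}$ is the multiple-counting sequence of $\rho$ between exponents of $x$, $J_n=\left\lfloor \frac{x^{n+1}}{\rho}\right\rfloor-\left\lfloor \frac{x^{n}}{\rho}\right\rfloor$, and $(S_n)_{n\ge 0}$ is the multiple-counting summation sequence of $\rho$, $S_n=\left\lfloor \frac{x^{n+1}}{\rho}\right\rfloor=\sum_{i=0}^{n}J_i$. Empty sums equal $0$ (in particular $\sum_{j=0}^{i-2}J_j=0$ for $i=1$). Here $\pi$ denotes the constant defined in the claim, not the circle constant. The number $\rho$ is not assumed to be prime. *)

theory Defs
  imports Main "HOL-Number_Theory.Cong"
begin

definition mult_count :: "nat \<Rightarrow> nat \<Rightarrow> nat \<Rightarrow> nat" where
  "mult_count x \<rho> n = card {m. \<rho> dvd m \<and> x ^ n < m \<and> m < x ^ (n + 1)}"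

definition mult_count_sum :: "nat \<Rightarrow> nat \<Rightarrow> nat \<Rightarrow> nat" where
  "mult_count_sum x \<rho> n = card {m. \<rho> dvd m \<and> 0 < m \<and> m < x ^ (n + 1)}"

text \<open>
  The range \<open>j < i - 1\<close> of the inner sum is \<open>0 \<le> j \<le> i - 2\<close> with the
  convention that it is empty for \<open>i = 1\<close>; writing \<open>{0..i - 2}\<close> over the naturals
  would wrongly include \<open>j = 0\<close> there.
\<close>

definition mult_const :: "nat \<Rightarrow> nat \<Rightarrow> int" where
  "mult_const x \<rho> =
     (\<Sum>i = 0..\<rho> - 2. int (mult_count x \<rho> i))
     - (int x - 1) * (\<Sum>i = 1..\<rho> - 1. \<Sum>j<i - 1. int (mult_count x \<rho> j))"

end

theory Submission
  imports Defs
begin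

text \<open>
  Since \<open>\<rho>\<close> divides no power of \<open>x\<close>, the counts are \<open>S\<^sub>n = F (n + 1)\<close> and
  \<open>J\<^sub>n = F (n + 1) - F n\<close> with \<open>F m = \<lfloor>x\<^sup>m / \<rho>\<rfloor>\<close>. Put \<open>p = \<rho> - 1\<close> and write \<open>x\<^sup>p = 1 + \<rho> c\<close>; then
  \<open>F (m + p) - F m = c x\<^sup>m\<close>, a geometric progression in \<open>m\<close> of ratio \<open>x\<close>. Hence
  \<open>F (m + p) - F m - (x - 1) \<Sum>\<^sub>k F (m + k)\<close>, the sum over \<open>k < p\<close>, does not depend on \<open>m\<close>. At \<open>m = 0\<close>
  its value is \<open>\<pi>\<close>, because the sums of the \<open>J\<^sub>j\<close> telescope.
\<close>

text \<open>Multiplication by \<open>d\<close> maps \<open>{a div d<..b div d}\<close> bijectively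
  onto the multiples in question. The closed right end does no harm, since \<open>d * k\<close>
  never equals \<open>b\<close>.\<close>

lemma card_multiples_between:
  fixes a b d :: nat
  assumes "d > 0" and "\<not> d dvd b"
  shows "card {m. d dvd m \<and> a < m \<and> m < b} = b div d - a div d"
proof -
  have iff: "a < d * k \<and> d * k < b \<longleftrightarrow> k \<in> {a div d<..b div d}" for k
  proof -
    have "d * k \<noteq> b"
      using assms(2) by auto
    then show ?thesis
      using assms(1) by (auto simp: div_less_iff_less_mult less_eq_div_iff_mult_less_eq mult.commute)
  qed
  have "{m. d dvd m \<and> a < m \<and> m < b} = (*) d ` {k. a < d * k \<and> d * k < b}"
    by auto
  then have "{m. d dvd m \<and> a < m \<and> m < b} = (*) d ` {a div d<..b div d}"
    by (simp only: iff Collect_mem_eq)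
  moreover have "inj_on ((*) d) {a div d<..b div d}"
    using assms(1) by (simp add: inj_on_def)
  ultimately show ?thesis
    by (simp add: card_image)
qed

text \<open>The congruence makes \<open>x ^ p\<close>, hence every power of \<open>x\<close>,
  coprime to \<open>d\<close>; a power divisible by \<open>d\<close> would force \<open>d\<close> to
  be a unit.\<close>

lemma not_dvd_power_of_cong_1:
  fixes x d p :: nat
  assumes "d \<ge> 2" and "p > 0" and "[x ^ p = 1] (mod d)"
  shows "\<not> d dvd x ^ n"
proof
  assume "d dvd x ^ n"
  have "coprime (x ^ p) d"
    using cong_imp_coprime[OF cong_sym[OF assms(3)]] by simp
  then have "coprime (x ^ n) d"
    using assms(2) by simp
  with \<open>d dvd x ^ n\<close> have "is_unit d"
    using coprime_common_divisor[of "x ^ n" d d] by simp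
  then show False
    using assms(1) by simp
qed

lemma power_div_periodic:
  fixes x d p :: nat
  assumes "d > 0" and "x ^ p = 1 + d * c"
  shows "x ^ (m + p) div d = x ^ m div d + c * x ^ m"
proof -
  have "x ^ (m + p) = x ^ m + d * (c * x ^ m)"
    using assms(2) by (simp add: power_add algebra_simps)
  then show ?thesis
    using assms(1) by simp
qed

text \<open>From \<open>m\<close> to \<open>Suc m\<close> the difference
  \<open>F (m + p) - F m\<close> grows by \<open>(y - 1) * c * y ^ m\<close>, while the window sum
  grows by \<open>c * y ^ m\<close>, so the left side stays constant.\<close>

lemma window_sum_recurrence:
  fixes F :: "nat \<Rightarrow> int"
  assumes "\<And>m. F (m + p) = F m + c * y ^ m"
  shows "F (m + p) - F m - (y - 1) * (\<Sum>k<p. F (m + k)) = F p - F 0 - (y - 1) * (\<Sum>k<p. F k)"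
proof (induction m)
  case (Suc m)
  have "(\<Sum>k<p. F (Suc m + k)) + F m = (\<Sum>k<Suc p. F (m + k))"
    by (simp only: sum.lessThan_Suc_shift) simp
  then have "(\<Sum>k<p. F (Suc m + k)) = (\<Sum>k<p. F (m + k)) + c * y ^ m"
    using assms[of m] by simp
  with Suc.IH show ?case
    using assms[of m] assms[of "Suc m"] by (simp add: algebra_simps)
qed simp

theorem theorem7:
  fixes x \<rho> :: nat
  assumes "x \<ge> 1" and "\<rho> \<ge> 2"
    and "[x ^ (\<rho> - 1) = 1] (mod \<rho>)"
  shows "(\<forall>n. int (mult_count_sum x \<rho> (n + \<rho> - 1)) =
            (int x - 1) * (\<Sum>i = 1..\<rho> - 2. int (mult_count_sum x \<rho> (n + \<rho> - 1 - i)))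
            + int x * int (mult_count_sum x \<rho> n) + mult_const x \<rho>) \<and>
         (\<forall>n. int (mult_count_sum x \<rho> (n + \<rho> - 1)) =
            (int x - 1) * (\<Sum>i = 1..\<rho> - 1. int (mult_count_sum x \<rho> (n + \<rho> - 1 - i)))
            + int (mult_count_sum x \<rho> n) + mult_const x \<rho>)"
proof -
  define p where "p = \<rho> - 1"
  define F where "F m = int (x ^ m div \<rho>)" for m
  have p: "p > 0" "\<rho> = Suc p" "[x ^ p = 1] (mod \<rho>)"
    using assms by (auto simp: p_def)
  have ndvd: "\<not> \<rho> dvd x ^ n" for n
    using not_dvd_power_of_cong_1[OF assms(2) p(1,3)] .
  have S: "int (mult_count_sum x \<rho> n) = F (Suc n)" for n
    using card_multiples_between[OF _ ndvd, of 0 "n + 1"] assms(2)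
    by (simp add: mult_count_sum_def F_def)
  have J: "int (mult_count x \<rho> n) = F (Suc n) - F n" for n
  proof -
    \<comment> \<open>Monotonicity turns the truncated difference of naturals into a true integer
      difference.\<close>
    have "x ^ n div \<rho> \<le> x ^ Suc n div \<rho>"
      using assms(1) by (intro div_le_mono power_increasing) auto
    then show ?thesis
      using card_multiples_between[OF _ ndvd, of "x ^ n" "n + 1"] assms(2)
      by (simp add: mult_count_def F_def)
  qed
  have F0: "F 0 = 0"
    using assms(2) by (simp add: F_def)
  have J_sum: "(\<Sum>j<k. int (mult_count x \<rho> j)) = F k" for k
    by (simp add: J sum_lessThan_telescope F0)
  have "{0..\<rho> - 2} = {..<p}"
    using p by auto
  \<comment> \<open>The inner sum for \<open>i\<close> telescopes to \<open>F (i - 1)\<close>, so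
    the outer one runs over \<open>F k\<close> with \<open>k = i - 1\<close>.\<close>
  then have pi: "mult_const x \<rho> = F p - (int x - 1) * (\<Sum>k<p. F k)"
    using sum.atLeast1_atMost_eq[of "\<lambda>i. F (i - 1)" p]
    by (simp add: mult_const_def J_sum p_def)
  obtain c where "x ^ p = 1 + \<rho> * c"
    using p(3) assms(1) cong_to_1_nat
    by (metis dvd_def le_add_diff_inverse one_le_power)
  then have "F (m + p) = F m + int c * int x ^ m" for m
    using power_div_periodic[of \<rho> x p c m] assms(2) by (simp add: F_def)
  note window_sum = window_sum_recurrence[of F p, OF this]
  have rec: "F (m + p) = (int x - 1) * (\<Sum>k<p. F (m + k)) + F m + mult_const x \<rho>" for m
    using window_sum[of m] F0 pi by linarith
  \<comment> \<open>The order of summation is reversed by \<open>k = p - i\<close>; the window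
    starts at \<open>Suc n\<close> because \<open>S\<close> shifts the index by one.\<close>
  have window: "(\<Sum>i = 1..\<rho> - 1. int (mult_count_sum x \<rho> (n + \<rho> - 1 - i))) = (\<Sum>k<p. F (Suc n + k))"
    for n
    unfolding S
    by (rule sum.reindex_bij_witness[of _ "\<lambda>k. p - k" "\<lambda>i. p - i"]) (auto simp: p(2))
  have full: "int (mult_count_sum x \<rho> (n + \<rho> - 1)) =
            (int x - 1) * (\<Sum>i = 1..\<rho> - 1. int (mult_count_sum x \<rho> (n + \<rho> - 1 - i)))
            + int (mult_count_sum x \<rho> n) + mult_const x \<rho>" for n
    unfolding window unfolding S using rec[of "Suc n"] by (simp add: p(2))
  \<comment> \<open>The term \<open>i = \<rho> - 1\<close> is the \<open>n\<close>-th count itself;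
    splitting it off changes its coefficient from 1 to \<open>x\<close>.\<close>
  have last: "(\<Sum>i = 1..\<rho> - 1. int (mult_count_sum x \<rho> (n + \<rho> - 1 - i))) =
      (\<Sum>i = 1..\<rho> - 2. int (mult_count_sum x \<rho> (n + \<rho> - 1 - i))) + int (mult_count_sum x \<rho> n)" for n
  proof -
    have "\<rho> - 1 = Suc (\<rho> - 2)" and "n + \<rho> - 1 - Suc (\<rho> - 2) = n"
      using assms(2) by auto
    then show ?thesis
      by simp
  qed
  show ?thesis
    using full unfolding last by (simp add: algebra_simps)
qed

end
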